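(* Let $p,q\in[0,1]$ with $p+q=1$ and $p>q$, and let $F_K=|p-q|$. Then $$\mathsf{U}(F_K,p)=\log 2-\mathscr{H}(p,q)=\log 2+p\log p+q\log q .$$
   Context: Binary game: $Z(1),\dots,Z(N)$ are i.i.d. with values in $\{-1,1\}$, $\mathsf{P}(Z(I)=1)=p$, $\mathsf{P}(Z(I)=-1)=q$. With initial wealth $W(0)>0$ and fixed bet fraction $F\in[0,1]$, $W(N)=W(0)\prod_{I=1}^N(1+F Z(I))$. The utility function is $$\mathsf{U}(F,p)=\mathsf{E}\left[\log\left|\frac{W(N)}{W(0)}\right|^{1/N}\right],$$ which equals $p\log(1+F)+q\log(1-F)$. The Shannon entropy is $\mathscr{H}(p,q)=-p\log p-q\log q$. $\log$ is the natural logarithm, with $\log 0=-\infty$ and $0\cdot(-\infty)=0$. *)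

theory Defs
  imports "HOL-Probability.Probability"
begin

text \<open>The logarithm has to take the value \<open>-\<infinity>\<close> at \<open>0\<close>, whereas \<open>ln 0 = 0\<close> in the library. In
  \<^typ>\<open>ereal\<close> the convention \<open>0 * (-\<infinity>) = 0\<close> holds already. Only arguments \<open>x \<ge> 0\<close> matter.\<close>

definition elog :: "real \<Rightarrow> ereal" where
  "elog x = (if x \<le> 0 then -\<infinity> else ereal (ln x))"

text \<open>Difference of the integrals of the positive and the negative part (\<^const>\<open>e2ennreal\<close>
  truncates at \<open>0\<close>). It is meaningful as soon as one of the two integrals is finite, for instance
  when \<open>X\<close> is bounded above; the value in the remaining case is a junk value.\<close>

definition eexpectation :: "'a measure \<Rightarrow> ('a \<Rightarrow> ereal) \<Rightarrow> ereal" where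
  "eexpectation M X =
     enn2ereal (\<integral>\<^sup>+\<omega>. e2ennreal (X \<omega>) \<partial>M) - enn2ereal (\<integral>\<^sup>+\<omega>. e2ennreal (- X \<omega>) \<partial>M)"

lemma eexpectation_eq_lebesgue_integral:
  assumes "integrable M f"
  shows "eexpectation M (\<lambda>\<omega>. ereal (f \<omega>)) = ereal (integral\<^sup>L M f)"
proof -
  have "(\<integral>\<^sup>+\<omega>. ennreal (f \<omega>) \<partial>M) \<noteq> \<infinity>" "(\<integral>\<^sup>+\<omega>. ennreal (- f \<omega>) \<partial>M) \<noteq> \<infinity>"
    using assms by (auto simp: real_integrable_def)
  then have *: "enn2ereal (\<integral>\<^sup>+\<omega>. ennreal (f \<omega>) \<partial>M) = ereal (enn2real (\<integral>\<^sup>+\<omega>. ennreal (f \<omega>) \<partial>M))"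
      "enn2ereal (\<integral>\<^sup>+\<omega>. ennreal (- f \<omega>) \<partial>M) = ereal (enn2real (\<integral>\<^sup>+\<omega>. ennreal (- f \<omega>) \<partial>M))"
    by (metis enn2ereal_ennreal enn2real_nonneg ennreal_enn2real infinity_ennreal_def top.not_eq_extremum)+
  show ?thesis
    by (simp add: eexpectation_def * real_lebesgue_integral_def[OF assms])
qed

text \<open>Neither \<open>p + q = 1\<close> nor the bounds on \<open>p\<close> and \<open>q\<close> need to be part of the locale: they
  follow when \<open>N \<ge> 1\<close>.\<close>

locale binary_game = prob_space M for M :: "'a measure" +
  fixes N :: nat and Z :: "nat \<Rightarrow> 'a \<Rightarrow> real" and p q :: real
  assumes N_pos: "N \<ge> 1"
    and Z_values: "\<And>i \<omega>. i \<in> {1..N} \<Longrightarrow> \<omega> \<in> space M \<Longrightarrow> Z i \<omega> \<in> {-1, 1}"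
    and Z_indep: "indep_vars (\<lambda>_. borel) Z {1..N}"
    and Z_win: "\<And>i. i \<in> {1..N} \<Longrightarrow> \<P>(\<omega> in M. Z i \<omega> = 1) = p"
    and Z_loss: "\<And>i. i \<in> {1..N} \<Longrightarrow> \<P>(\<omega> in M. Z i \<omega> = -1) = q"

definition wealth :: "(nat \<Rightarrow> 'a \<Rightarrow> real) \<Rightarrow> real \<Rightarrow> real \<Rightarrow> nat \<Rightarrow> 'a \<Rightarrow> real" where
  "wealth Z W0 F n \<omega> = W0 * (\<Prod>i=1..n. 1 + F * Z i \<omega>)"

text \<open>The success probability \<open>p\<close> enters only through the law of \<open>Z\<close> under \<open>M\<close>.\<close>

definition utility :: "'a measure \<Rightarrow> nat \<Rightarrow> (nat \<Rightarrow> 'a \<Rightarrow> real) \<Rightarrow> real \<Rightarrow> real \<Rightarrow> ereal" where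
  "utility M N Z W0 F =
     eexpectation M (\<lambda>\<omega>. elog (\<bar>wealth Z W0 F N \<omega> / W0\<bar> powr (1 / real N)))"

definition shannon_entropy :: "real \<Rightarrow> real \<Rightarrow> ereal" where
  "shannon_entropy p q = - (ereal p * elog p) - ereal q * elog q"

end

theory Submission
  imports Defs
begin

text \<open>The Kelly fraction turns the two possible growth factors \<open>1 + F\<close> and \<open>1 - F\<close> into \<open>2 p\<close> and
  \<open>2 q\<close>. By linearity of expectation the utility is
  \<open>p ln (2 p) + q ln (2 q)\<close>. If \<open>q = 0\<close>, ruin is possible only on a null set, so that the
  extended logarithm still agrees almost everywhere with an integrable real function.\<close>

lemma eexpectation_cong_AE:
  assumes "AE \<omega> in M. X \<omega> = Y \<omega>"
  shows "eexpectation M X = eexpectation M Y"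
proof -
  have "(\<integral>\<^sup>+\<omega>. e2ennreal (X \<omega>) \<partial>M) = (\<integral>\<^sup>+\<omega>. e2ennreal (Y \<omega>) \<partial>M)"
    "(\<integral>\<^sup>+\<omega>. e2ennreal (- X \<omega>) \<partial>M) = (\<integral>\<^sup>+\<omega>. e2ennreal (- Y \<omega>) \<partial>M)"
    using assms by (auto intro!: nn_integral_cong_AE)
  then show ?thesis
    by (simp add: eexpectation_def)
qed

text \<open>At \<open>x = 0\<close> the two conventions for the logarithm agree, since a factor
  \<open>0\<close> annihilates \<open>-\<infinity>\<close> as well as \<open>ln 0\<close>.\<close>

lemma mult_elog: "0 \<le> x \<Longrightarrow> ereal x * elog x = ereal (x * ln x)"
  by (cases "x = 0") (auto simp: elog_def zero_ereal_def[symmetric])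

lemma elog_growth_rate:
  assumes "W0 \<noteq> 0" and pos: "\<And>i. i \<in> {1..N} \<Longrightarrow> 0 < 1 + F * Z i \<omega>"
  shows "elog (\<bar>wealth Z W0 F N \<omega> / W0\<bar> powr (1 / real N))
    = ereal ((\<Sum>i=1..N. ln (1 + F * Z i \<omega>)) / real N)"
proof -
  let ?P = "\<Prod>i=1..N. 1 + F * Z i \<omega>"
  have P: "0 < ?P"
    using pos by (intro prod_pos) auto
  have "ln ?P = (\<Sum>i=1..N. ln (1 + F * Z i \<omega>))"
    using less_imp_neq[OF pos] by (intro ln_prod) auto
  moreover have "\<bar>wealth Z W0 F N \<omega> / W0\<bar> = ?P"
    using assms(1) P by (simp add: wealth_def)
  moreover have "elog (x powr (1 / real N)) = ereal (ln x / real N)" if "0 < x" for x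
    using that by (simp add: elog_def ln_powr)
  ultimately show ?thesis
    using P by metis
qed

context binary_game
begin

lemma Z_measurable: "i \<in> {1..N} \<Longrightarrow> Z i \<in> borel_measurable M"
  using Z_indep by (auto simp: indep_vars_def)

text \<open>As \<open>Z i\<close> takes only two values, the integrand is a combination of two
  indicators. Hence integrability holds for every real \<open>F\<close>, whatever value
  \<open>ln\<close> has at nonpositive arguments.\<close>

lemma has_bochner_integral_ln_factor:
  assumes i: "i \<in> {1..N}"
  shows "has_bochner_integral M (\<lambda>\<omega>. ln (1 + F * Z i \<omega>)) (p * ln (1 + F) + q * ln (1 - F))"
proof -
  note [measurable] = Z_measurable[OF i]
  let ?A = "\<lambda>z. {\<omega> \<in> space M. Z i \<omega> = z}"
  have A: "has_bochner_integral M (\<lambda>\<omega>. indicator (?A z) \<omega> * c) (prob (?A z) * c)" for z c :: real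
    by (intro has_bochner_integral_mult_left has_bochner_integral_real_indicator)
      (auto simp: emeasure_eq_measure)
  have "has_bochner_integral M
      (\<lambda>\<omega>. indicator (?A 1) \<omega> * ln (1 + F) + indicator (?A (-1)) \<omega> * ln (1 - F))
      (p * ln (1 + F) + q * ln (1 - F))"
    using has_bochner_integral_add[OF A[of 1 "ln (1 + F)"] A[of "-1" "ln (1 - F)"]]
    by (simp add: Z_win[OF i] Z_loss[OF i])
  moreover have "indicator (?A 1) \<omega> * ln (1 + F) + indicator (?A (-1)) \<omega> * ln (1 - F)
      = ln (1 + F * Z i \<omega>)" if "\<omega> \<in> space M" for \<omega>
    using Z_values[OF i that] that by (auto simp: indicator_def)
  ultimately show ?thesis
    by (simp cong: has_bochner_integral_cong)
qed

text \<open>A nonpositive factor \<open>1 + F\<close> or \<open>1 - F\<close> can only arise from an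
  outcome of probability \<open>0\<close>, and the finitely many rounds contribute finitely many
  null sets.\<close>

lemma AE_factor_pos:
  assumes "p = 0 \<or> 0 < 1 + F" and "q = 0 \<or> 0 < 1 - F"
  shows "AE \<omega> in M. \<forall>i\<in>{1..N}. 0 < 1 + F * Z i \<omega>"
proof (rule AE_finite_allI)
  fix i assume i: "i \<in> {1..N}"
  note [measurable] = Z_measurable[OF i]
  have "AE \<omega> in M. Z i \<omega> \<noteq> z" if "\<P>(\<omega> in M. Z i \<omega> = z) = 0" for z
    using that by (subst (asm) prob_eq_0) auto
  then have "AE \<omega> in M. Z i \<omega> = 1 \<longrightarrow> 0 < 1 + F" "AE \<omega> in M. Z i \<omega> = -1 \<longrightarrow> 0 < 1 - F"
    using assms Z_win[OF i] Z_loss[OF i] by fastforce+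
  with AE_space show "AE \<omega> in M. 0 < 1 + F * Z i \<omega>"
    by eventually_elim (use Z_values[OF i] in force)
qed simp

text \<open>The library's \<open>ln 0 = 0\<close> is harmless here: a vanishing growth factor is multiplied by the
  probability \<open>0\<close>.\<close>

theorem utility_eq:
  assumes "W0 \<noteq> 0" and "p = 0 \<or> 0 < 1 + F" and "q = 0 \<or> 0 < 1 - F"
  shows "utility M N Z W0 F = ereal (p * ln (1 + F) + q * ln (1 - F))"
proof -
  let ?c = "p * ln (1 + F) + q * ln (1 - F)"
  let ?f = "\<lambda>\<omega>. (\<Sum>i=1..N. ln (1 + F * Z i \<omega>)) / real N"
  have "has_bochner_integral M ?f ((\<Sum>i=1..N. ?c) / real N)"
    by (intro has_bochner_integral_divide_zero has_bochner_integral_sum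
        has_bochner_integral_ln_factor)
  \<comment> \<open>The \<open>N\<close> equal summands cancel against the divisor \<open>N\<close>,
    which is nonzero by \<open>N_pos\<close>.\<close>
  then have f: "has_bochner_integral M ?f ?c"
    using N_pos by simp
  \<comment> \<open>Outside the null set where some factor is nonpositive, \<open>elog\<close> is
    finite and the \<open>N\<close>-th root of the product becomes an arithmetic mean of
    logarithms.\<close>
  have "utility M N Z W0 F = eexpectation M (\<lambda>\<omega>. ereal (?f \<omega>))"
    unfolding utility_def
    using AE_factor_pos[OF assms(2,3)]
    by (intro eexpectation_cong_AE, eventually_elim) (intro elog_growth_rate assms(1), blast)
  also have "\<dots> = ereal ?c"
    using f by (simp add: eexpectation_eq_lebesgue_integral has_bochner_integral_iff)
  finally show ?thesis .
qed

end

theorem lemma3p5: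
  fixes M :: "'a measure" and N :: nat and Z :: "nat \<Rightarrow> 'a \<Rightarrow> real" and W0 p q F_K :: real
  assumes "p \<in> {0..1}" and "q \<in> {0..1}" and "p + q = 1" and "p > q"
    and "binary_game M N Z p q"
    and "W0 > 0"
    and "F_K = \<bar>p - q\<bar>"
  shows "utility M N Z W0 F_K = elog 2 - shannon_entropy p q
    \<and> elog 2 - shannon_entropy p q = elog 2 + ereal p * elog p + ereal q * elog q"
proof -
  have pq: "0 < p" "0 \<le> q"
    using assms by auto
  have F: "1 + F_K = 2 * p" "1 - F_K = 2 * q"
    using assms by auto
  have "utility M N Z W0 F_K = ereal (p * ln (2 * p) + q * ln (2 * q))"
    unfolding F[symmetric] using assms by (intro binary_game.utility_eq[OF assms(5)]) auto
  \<comment> \<open>The logarithm of \<open>2 * q\<close> splits only for nonzero \<open>q\<close>;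
    if \<open>q = 0\<close>, every term with the factor \<open>q\<close> vanishes.\<close>
  also have "p * ln (2 * p) + q * ln (2 * q) = (p + q) * ln 2 + p * ln p + q * ln q"
    using pq by (cases "q = 0") (simp_all add: ln_mult algebra_simps)
  finally have "utility M N Z W0 F_K = ereal (ln 2 + p * ln p + q * ln q)"
    by (simp add: assms)
  moreover have "elog 2 = ereal (ln 2)"
    by (simp add: elog_def)
  ultimately show ?thesis
    using assms by (simp add: shannon_entropy_def mult_elog)
qed

end
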